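(* For each $\alpha\in(0,2]$, the Linnik distribution with parameter $\alpha$ is a scale mixture of Laplace laws: $$L_{\alpha}\stackrel{d}{=}\Lambda\sqrt{\frac{S_{\alpha/2,1}}{S'_{\alpha/2,1}}},$$ where $S_{\alpha/2,1}$ and $S'_{\alpha/2,1}$ have one and the same one-sided strictly stable distribution with characteristic exponent $\alpha/2$, $\Lambda$ has the Laplace density $\frac12e^{-|x|}$, $x\in\mathbb{R}$, and the random variables $\Lambda$, $S_{\alpha/2,1}$, $S'_{\alpha/2,1}$ are independent.
   Context: $\stackrel{d}{=}$ denotes equality in distribution. For $\alpha\in(0,2]$, $L_\alpha$ has the Linnik distribution with parameter $\alpha$, i.e. characteristic function $1/(1+|t|^{\alpha})$, $t\in\mathbb{R}$. For $\beta\in(0,1]$, $S_{\beta,1}$ denotes a nonnegative random variable with the one-sided strictly stable distribution with characteristic exponent $\beta$, i.e. with characteristic function $\exp\{-|t|^{\beta}\exp\{-\frac12 i\pi\beta\,\mathrm{sign}\,t\}\}$, equivalently with Laplace transform $\mathsf{E}e^{-sS_{\beta,1}}=e^{-s^{\beta}}$, $s\ge0$ (so $S_{1,1}=1$ almost surely). *)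

theory Defs
  imports "HOL-Probability.Probability"
begin

definition linnik_distribution :: "real \<Rightarrow> real measure \<Rightarrow> bool" where
  "linnik_distribution \<alpha> D \<longleftrightarrow>
     real_distribution D \<and>
     (\<forall>t. char D t = complex_of_real (1 / (1 + \<bar>t\<bar> powr \<alpha>)))"

text \<open>
  The law of \<open>S\<^bsub>\<beta>,1\<^esub>\<close>, for \<open>\<beta> \<in> (0, 1]\<close>. As a condition on a law,
  nonnegativity of the random variable is required almost surely.
\<close>
definition one_sided_stable_distribution :: "real \<Rightarrow> real measure \<Rightarrow> bool" where
  "one_sided_stable_distribution \<beta> D \<longleftrightarrow>
     real_distribution D \<and>
     (AE x in D. 0 \<le> x) \<and>
     (\<forall>t. char D t =
        exp (- (complex_of_real (\<bar>t\<bar> powr \<beta>) *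
                exp (- (\<i> * complex_of_real (pi * \<beta> * sgn t / 2))))))"

definition laplace_density :: "real \<Rightarrow> real" where
  "laplace_density x = exp (- \<bar>x\<bar>) / 2"

end

theory Submission
  imports Defs "HOL-Complex_Analysis.Conformal_Mappings" "HOL-Real_Asymp.Real_Asymp"
begin

text \<open>
  By uniqueness of characteristic functions it is enough to show that the product has
  characteristic function \<open>1 / (1 + \<bar>t\<bar> powr \<alpha>)\<close>. The Laplace law has characteristic function
  \<open>1 / (1 + t\<^sup>2)\<close>, so conditioning on the independent scale \<open>sqrt (S / S')\<close> reduces the claim to
  computing the expectation of \<open>1 / (1 + t\<^sup>2 * S / S') = S' / (S' + t\<^sup>2 * S)\<close>
  (\<open>char_laplace_scale_mixture\<close>).

  Put \<open>b = \<alpha> / 2\<close> and \<open>c = t\<^sup>2\<close>. The quotient is the integral over \<open>u > 0\<close> of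
  \<open>S' * exp (- u * S') * exp (- c * u * S)\<close>, in which the two variables are separated. With
  \<open>E exp (- u * S) = exp (- u powr b)\<close> and its derivative in \<open>u\<close>, Tonelli turns the expectation into
  the integral over \<open>u > 0\<close> of \<open>b * u powr (b - 1) * exp (- (1 + c powr b) * u powr b)\<close>, which is
  \<open>1 / (1 + c powr b) = 1 / (1 + \<bar>t\<bar> powr \<alpha>)\<close> (\<open>nn_integral_stable_ratio\<close>).

  The stable law is given by its characteristic function, so its Laplace transform has to be
  derived. Both the Laplace transform of a law on the half-line and \<open>exp (- z powr b)\<close> are continuous
  on the closed right half-plane and holomorphic inside, and on the imaginary axis their equality is
  the defining formula. A function of this kind that vanishes on the imaginary axis is zero, by
  Schwarz reflection (\<open>halfplane_eq_0\<close>), which gives \<open>laplace_transform_stable\<close>.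
\<close>

section \<open>The Laplace transform of a law on the half-line\<close>

definition laplace_transform :: "real measure \<Rightarrow> complex \<Rightarrow> complex" where
  "laplace_transform D z = (CLINT x|D. exp (- (z * complex_of_real x)))"

lemma norm_exp_minus_le_1:
  assumes "0 \<le> x" "0 \<le> Re z"
  shows "cmod (exp (- (z * complex_of_real x))) \<le> 1"
  using assms by simp

text \<open>
  Makes the integrand \<open>x * exp (- (d * x))\<close> bounded on the half-line, hence integrable against a
  probability law that may have no first moment. This is why the Laplace transform is
  differentiable inside the half-plane although stable laws of index below 1 have infinite mean.
\<close>
lemma mult_exp_minus_le:
  fixes d x :: real
  assumes "0 < d"
  shows "x * exp (- (d * x)) \<le> 1 / d"
proof -
  have "d * x \<le> exp (d * x)"
    using exp_ge_add_one_self[of "d * x"] by linarith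
  then show ?thesis
    using assms by (simp add: exp_minus field_simps)
qed

lemma continuous_on_laplace_transform:
  assumes "real_distribution D" and nonneg: "AE x in D. 0 \<le> x"
  shows "continuous_on {z. 0 \<le> Re z} (laplace_transform D)"
proof -
  interpret real_distribution D by fact
  have "(\<lambda>i. laplace_transform D (X i)) \<longlonglongrightarrow> laplace_transform D z"
    if "\<forall>i. 0 \<le> Re (X i)" "X \<longlonglongrightarrow> z" for X z
    unfolding laplace_transform_def
  proof (rule integral_dominated_convergence[where w = "\<lambda>_. 1"])
    show "AE x in D. (\<lambda>i. exp (- (X i * complex_of_real x))) \<longlonglongrightarrow> exp (- (z * complex_of_real x))"
      using that(2) by (intro AE_I2 tendsto_intros)
    show "AE x in D. cmod (exp (- (X i * complex_of_real x))) \<le> 1" for i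
      using nonneg by eventually_elim (use that(1) in \<open>auto intro: norm_exp_minus_le_1\<close>)
  qed auto
  then show ?thesis
    by (auto simp: continuous_on_sequentially comp_def)
qed

text \<open>
  Differentiation under the integral sign, by dominated convergence of the difference quotients.
  On the half-plane to the right of \<open>Re z / 2\<close> the derivative of the integrand is bounded uniformly
  in \<open>x\<close>, so by the mean value inequality the difference quotients obey the same bound.
\<close>
lemma has_field_derivative_laplace_transform:
  assumes "real_distribution D" and nonneg: "AE x in D. 0 \<le> x" and z: "0 < Re z"
  shows "(laplace_transform D has_field_derivative
     (CLINT x|D. - of_real x * exp (- (z * complex_of_real x)))) (at z)"
proof -
  interpret real_distribution D by fact
  define d where "d = Re z / 2"
  have d: "0 < d" "d < Re z"
    using z by (auto simp: d_def)
  define H where "H = {w. d < Re w}"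
  have H: "open H" "z \<in> H" "convex H"
    using d by (auto simp: H_def open_halfspace_Re_gt convex_halfspace_Re_gt)
  have bound: "cmod (- of_real x * exp (- (w * complex_of_real x))) \<le> 1 / d"
    if "0 \<le> x" "w \<in> H" for w x
  proof -
    have "cmod (- of_real x * exp (- (w * complex_of_real x))) = x * exp (- (Re w * x))"
      using that by (simp add: norm_mult)
    also have "\<dots> \<le> x * exp (- (d * x))"
      using that by (intro mult_left_mono) (auto simp: H_def mult_right_mono)
    also have "\<dots> \<le> 1 / d"
      using d by (intro mult_exp_minus_le)
    finally show ?thesis .
  qed
  have integrable: "integrable D (\<lambda>x. exp (- (w * complex_of_real x)))" if "w \<in> H" for w
  proof -
    have "0 \<le> Re w" using that d by (auto simp: H_def)
    with nonneg show ?thesis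
      by (intro integrable_const_bound[of _ 1]) auto
  qed
  let ?q = "\<lambda>w x. (exp (- (w * complex_of_real x)) - exp (- (z * complex_of_real x))) / (w - z)"
  have deriv: "((\<lambda>w. exp (- (w * complex_of_real x)))
      has_field_derivative - of_real x * exp (- (w * complex_of_real x))) (at w)" for w x
    by (auto intro!: derivative_eq_intros)
  have lim: "(\<lambda>i. CLINT x|D. ?q (X i) x)
      \<longlonglongrightarrow> (CLINT x|D. - of_real x * exp (- (z * complex_of_real x)))"
    if X: "\<forall>i. X i \<in> H - {z}" "X \<longlonglongrightarrow> z" for X
  proof (rule integral_dominated_convergence[where w = "\<lambda>_. 1 / d"])
    show "AE x in D. (\<lambda>i. ?q (X i) x) \<longlonglongrightarrow> - of_real x * exp (- (z * complex_of_real x))"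
    proof (rule AE_I2)
      fix x
      have "((\<lambda>w. ?q w x) \<longlongrightarrow> - of_real x * exp (- (z * complex_of_real x))) (at z)"
        using deriv[of x z] by (simp add: has_field_derivative_iff)
      moreover have "filterlim X (at z) sequentially"
        using X by (auto simp: filterlim_at)
      ultimately show "(\<lambda>i. ?q (X i) x) \<longlonglongrightarrow> - of_real x * exp (- (z * complex_of_real x))"
        by (rule filterlim_compose)
    qed
    show "AE x in D. cmod (?q (X i) x) \<le> 1 / d" for i
      using nonneg
    proof eventually_elim
      case (elim x)
      have "cmod (exp (- (X i * complex_of_real x)) - exp (- (z * complex_of_real x)))
          \<le> 1 / d * cmod (X i - z)"
        using X H elim by (intro field_differentiable_bound[OF H(3) has_field_derivative_at_within[OF deriv]] bound) auto
      then show ?case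
        using X by (simp add: norm_divide divide_le_eq)
    qed
  qed auto
  have quot: "(CLINT x|D. ?q w x) = (laplace_transform D w - laplace_transform D z) / (w - z)"
    if "w \<in> H" for w
    using integrable[OF that] integrable[OF H(2)] by (simp add: laplace_transform_def)
  have "((\<lambda>w. (laplace_transform D w - laplace_transform D z) / (w - z))
      \<longlongrightarrow> (CLINT x|D. - of_real x * exp (- (z * complex_of_real x)))) (at z within H)"
    unfolding tendsto_at_iff_sequentially
  proof (intro allI impI)
    fix X assume X: "\<forall>i. X i \<in> H - {z}" "X \<longlonglongrightarrow> z"
    have "(\<lambda>i. CLINT x|D. ?q (X i) x) = (\<lambda>w. (laplace_transform D w - laplace_transform D z) / (w - z)) \<circ> X"
      unfolding comp_def using X(1) by (intro ext quot) auto
    then show "((\<lambda>w. (laplace_transform D w - laplace_transform D z) / (w - z)) \<circ> X)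
        \<longlonglongrightarrow> (CLINT x|D. - of_real x * exp (- (z * complex_of_real x)))"
      using lim[OF X] by (simp only:)
  qed
  then show "(laplace_transform D has_field_derivative
         (CLINT x|D. - of_real x * exp (- (z * complex_of_real x)))) (at z)"
    by (simp only: has_field_derivative_iff at_within_open[OF H(2,1)])
qed

section \<open>The Laplace transform of the one-sided stable law\<close>

text \<open>
  Rotate the right half-plane to the upper one. The boundary values on the real axis are
  zero, in particular real, so Schwarz reflection extends the function to an entire one; that entire function vanishes
  on the real axis and therefore everywhere.
\<close>
lemma halfplane_eq_0:
  fixes g :: "complex \<Rightarrow> complex"
  assumes holo: "g holomorphic_on {z. 0 < Re z}"
    and cont: "continuous_on {z. 0 \<le> Re z} g"
    and zero: "\<And>z. Re z = 0 \<Longrightarrow> g z = 0"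
    and z: "0 < Re z"
  shows "g z = 0"
proof -
  define f where "f w = g (- \<i> * w)" for w
  define h where "h w = (if 0 \<le> Im w then f w else cnj (f (cnj w)))" for w
  have real: "f w = 0" if "w \<in> \<real>" for w
    using that by (auto simp: f_def elim!: Reals_cases intro!: zero)
  have holo_h: "h holomorphic_on UNIV"
    unfolding h_def
  proof (rule Schwarz_reflection)
    have "g \<circ> (\<lambda>w. - \<i> * w) holomorphic_on {w. 0 < Im w}"
      by (rule holomorphic_on_compose_gen[OF _ holo]) (auto intro!: holomorphic_intros)
    then show "f holomorphic_on UNIV \<inter> {w. 0 < Im w}"
      by (simp add: f_def[abs_def] comp_def)
    have "continuous_on {w. 0 \<le> Im w} (\<lambda>w. g (- \<i> * w))"
      by (rule continuous_on_compose2[OF cont]) (auto intro!: continuous_intros)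
    then show "continuous_on (UNIV \<inter> {w. 0 \<le> Im w}) f"
      by (simp add: f_def[abs_def])
  qed (auto simp: real)
  have lim: "(0::complex) islimpt \<real>"
  proof -
    have "(\<lambda>n. complex_of_real (1 / real (Suc n))) \<longlonglongrightarrow> of_real 0"
      by (intro tendsto_of_real lim_1_over_n[THEN LIMSEQ_Suc])
    then show ?thesis
      unfolding islimpt_sequential
      by (intro exI[of _ "\<lambda>n. complex_of_real (1 / real (Suc n))"]) (auto simp del: of_nat_Suc)
  qed
  have "h (\<i> * z) = 0"
    by (rule analytic_continuation[where U = "\<real>" and S = UNIV, OF holo_h _ _ _ _ lim]) (auto simp: h_def real elim!: Reals_cases)
  then show ?thesis
    using z by (simp add: h_def f_def flip: mult.assoc)
qed

text \<open>
  The boundary values of the principal branch of \<open>z powr b\<close> at \<open>z = - \<i> * t\<close>: up to sign, they are the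
  exponent in the characteristic function of the one-sided stable law.
\<close>
lemma powr_imaginary:
  assumes "0 < b"
  shows "(- \<i> * complex_of_real t) powr complex_of_real b
    = complex_of_real (\<bar>t\<bar> powr b) * exp (- (\<i> * complex_of_real (pi * b * sgn t / 2)))"
proof (cases "t = 0")
  case False
  have "Ln (- \<i> * complex_of_real t) = of_real (ln \<bar>t\<bar>) - \<i> * of_real (pi * sgn t / 2)"
  proof (cases "0 < t")
    case True
    then show ?thesis
      using Ln_times_of_real[of t "- \<i>"] by (simp add: mult.commute Ln_of_real)
  next
    case neg: False
    with False have "t < 0" by simp
    then show ?thesis
      using Ln_times_of_real[of "- t" "\<i>"] Ln_of_real[of "- t"] by (simp add: mult.commute)
  qed
  then have "complex_of_real b * Ln (- \<i> * complex_of_real t)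
      = of_real (b * ln \<bar>t\<bar>) + - (\<i> * of_real (pi * b * sgn t / 2))"
    by (simp only:) (simp add: algebra_simps)
  then have "(- \<i> * complex_of_real t) powr complex_of_real b
      = exp (of_real (b * ln \<bar>t\<bar>)) * exp (- (\<i> * of_real (pi * b * sgn t / 2)))"
    using False by (simp only: powr_def exp_add) simp
  also have "exp (complex_of_real (b * ln \<bar>t\<bar>)) = of_real (\<bar>t\<bar> powr b)"
    using False by (subst exp_of_real) (simp add: powr_def)
  finally show ?thesis .
qed auto

text \<open>
  The Laplace transform at \<open>z = - \<i> * t\<close> is the characteristic function at \<open>t\<close>. So both sides are
  continuous on the closed half-plane, holomorphic inside, and agree on the imaginary axis.
\<close>
lemma laplace_transform_stable:
  assumes b: "0 < b" "b \<le> 1" and D: "one_sided_stable_distribution b D" and z: "0 < Re z"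
  shows "laplace_transform D z = exp (- (z powr of_real b))"
proof -
  have rd: "real_distribution D" and nonneg: "AE x in D. 0 \<le> x"
    and char: "\<And>t. char D t =
        exp (- (complex_of_real (\<bar>t\<bar> powr b) * exp (- (\<i> * complex_of_real (pi * b * sgn t / 2)))))"
    using D by (auto simp: one_sided_stable_distribution_def)
  have "laplace_transform D z - exp (- (z powr of_real b)) = 0"
  proof (rule halfplane_eq_0[OF _ _ _ z, where g = "\<lambda>z. laplace_transform D z - exp (- (z powr of_real b))"])
    have "laplace_transform D holomorphic_on {z. 0 < Re z}"
      using has_field_derivative_laplace_transform[OF rd nonneg]
      by (subst holomorphic_on_open) (auto simp: open_halfspace_Re_gt)
    then show "(\<lambda>z. laplace_transform D z - exp (- (z powr of_real b))) holomorphic_on {z. 0 < Re z}"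
      by (intro holomorphic_intros) (auto simp: complex_nonpos_Reals_iff)
    show "continuous_on {z. 0 \<le> Re z} (\<lambda>z. laplace_transform D z - exp (- (z powr of_real b)))"
      using b by (intro continuous_intros continuous_on_laplace_transform[OF rd nonneg]) auto
  next
    fix z :: complex assume "Re z = 0"
    then have z: "z = - \<i> * of_real (- Im z)"
      by (auto simp: complex_eq_iff)
    have "laplace_transform D z = char D (- Im z)"
      by (subst z) (simp add: laplace_transform_def char_def mult_ac)
    also have "\<dots> = exp (- (z powr of_real b))"
      unfolding char by (subst (2) z, subst powr_imaginary[OF b(1)]) simp
    finally show "laplace_transform D z - exp (- (z powr of_real b)) = 0"
      by simp
  qed
  then show ?thesis by simp
qed

section \<open>Expectations under one-sided stable laws\<close>

lemma one_sided_stable_distributionD: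
  assumes "one_sided_stable_distribution b D"
  shows "real_distribution D" and "AE x in D. 0 \<le> x"
  using assms by (auto simp: one_sided_stable_distribution_def)

lemma nn_integral_exp_stable:
  assumes b: "0 < b" "b \<le> 1" and D: "one_sided_stable_distribution b D" and u: "0 \<le> u"
  shows "(\<integral>\<^sup>+x. ennreal (exp (- (u * x))) \<partial>D) = ennreal (exp (- (u powr b)))"
proof -
  note nonneg = one_sided_stable_distributionD(2)[OF D]
  interpret real_distribution D
    by (rule one_sided_stable_distributionD(1)[OF D])
  show ?thesis
  proof (cases "u = 0")
    case True
    then show ?thesis
      using emeasure_space_1 by simp
  next
    case False
    with u have "0 < u" by simp
    have "integrable D (\<lambda>x. exp (- (u * x)))"
      using nonneg u by (intro integrable_const_bound[of _ 1]) auto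
    then have "(\<integral>\<^sup>+x. ennreal (exp (- (u * x))) \<partial>D) = ennreal (\<integral>x. exp (- (u * x)) \<partial>D)"
      by (intro nn_integral_eq_integral) auto
    also have "complex_of_real (\<integral>x. exp (- (u * x)) \<partial>D) = laplace_transform D (of_real u)"
      by (simp add: laplace_transform_def flip: exp_of_real integral_complex_of_real)
    then have "complex_of_real (\<integral>x. exp (- (u * x)) \<partial>D) = of_real (exp (- (u powr b)))"
      using \<open>0 < u\<close> b by (simp add: laplace_transform_stable[OF b D] powr_of_real flip: exp_of_real)
    then have "(\<integral>x. exp (- (u * x)) \<partial>D) = exp (- (u powr b))"
      by (simp only: of_real_eq_iff)
    finally show ?thesis .
  qed
qed

text \<open>
  The derivative at \<open>u\<close> of the two expressions for the Laplace transform, once under the integral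
  sign and once explicitly.
\<close>
lemma nn_integral_mult_exp_stable:
  assumes b: "0 < b" "b \<le> 1" and D: "one_sided_stable_distribution b D" and u: "0 < u"
  shows "(\<integral>\<^sup>+x. ennreal (x * exp (- (u * x))) \<partial>D)
    = ennreal (b * u powr (b - 1) * exp (- (u powr b)))"
proof -
  note nonneg = one_sided_stable_distributionD(2)[OF D]
  interpret real_distribution D
    by (rule one_sided_stable_distributionD(1)[OF D])
  let ?c = "complex_of_real"
  have ru: "0 < Re (?c u)" using u by simp
  note deriv = has_field_derivative_laplace_transform[OF real_distribution_axioms nonneg ru]
  have "((\<lambda>z. exp (- (z powr ?c b))) has_field_derivative
      - (?c b * ?c u powr (?c b - 1) * exp (- (?c u powr ?c b)))) (at (?c u))"
    using u by (auto intro!: derivative_eq_intros simp: complex_nonpos_Reals_iff)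
  then have "(laplace_transform D has_field_derivative
      - (?c b * ?c u powr (?c b - 1) * exp (- (?c u powr ?c b)))) (at (?c u))"
    by (rule has_field_derivative_transform_within_open[where S = "{z. 0 < Re z}"])
       (auto simp: open_halfspace_Re_gt u laplace_transform_stable[OF b D])
  from DERIV_unique[OF deriv this]
  have "(CLINT x|D. ?c x * exp (- (?c u * ?c x)))
      = ?c b * ?c u powr (?c b - 1) * exp (- (?c u powr ?c b))"
    by simp
  also have "\<dots> = ?c (b * u powr (b - 1) * exp (- (u powr b)))"
    using u powr_of_real[of u "b - 1"] powr_of_real[of u b] b by (simp flip: exp_of_real)
  also have "(CLINT x|D. ?c x * exp (- (?c u * ?c x))) = ?c (\<integral>x. x * exp (- (u * x)) \<partial>D)"
    by (simp flip: exp_of_real integral_complex_of_real)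
  finally have "(\<integral>x. x * exp (- (u * x)) \<partial>D) = b * u powr (b - 1) * exp (- (u powr b))"
    by (simp only: of_real_eq_iff)
  moreover have "integrable D (\<lambda>x. x * exp (- (u * x)))"
    using nonneg by (intro integrable_const_bound[of _ "1 / u"]) (auto simp: mult_exp_minus_le[OF u])
  ultimately show ?thesis
    using nonneg by (subst nn_integral_eq_integral) auto
qed

text \<open>
  An atom at the origin would keep the Laplace transform away from 0 at infinity, whereas
  \<open>exp (- (u powr b))\<close> tends to 0. This makes division by a stable variable legitimate almost surely.
\<close>
lemma AE_stable_pos:
  assumes b: "0 < b" "b \<le> 1" and D: "one_sided_stable_distribution b D"
  shows "AE x in D. 0 < x"
proof -
  note nonneg = one_sided_stable_distributionD(2)[OF D]
  interpret real_distribution D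
    by (rule one_sided_stable_distributionD(1)[OF D])
  have le: "emeasure D {0} \<le> ennreal (exp (- (u powr b)))" if "0 \<le> u" for u
  proof -
    have "emeasure D {0} = (\<integral>\<^sup>+x. indicator {0} x \<partial>D)"
      by simp
    also have "\<dots> \<le> (\<integral>\<^sup>+x. ennreal (exp (- (u * x))) \<partial>D)"
      by (intro nn_integral_mono) (auto simp: indicator_def)
    finally show ?thesis
      by (simp add: nn_integral_exp_stable[OF b D that])
  qed
  have "((\<lambda>u. exp (- (u powr b))) \<longlongrightarrow> 0) at_top"
    using b by real_asymp
  then have "((\<lambda>u. ennreal (exp (- (u powr b)))) \<longlongrightarrow> ennreal 0) at_top"
    by (rule tendsto_ennrealI)
  then have "emeasure D {0} \<le> ennreal 0"
    by (rule tendsto_lowerbound) (auto intro: eventually_mono[OF eventually_ge_at_top[of 0]] le)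
  then have "AE x in D. x \<noteq> 0"
    by (intro AE_I[where N = "{0}"]) auto
  with nonneg show ?thesis
    by eventually_elim auto
qed

text \<open>
  Used twice: for \<open>b = 1\<close> it represents a reciprocal as an integral of exponentials, and for the
  stable index \<open>b\<close> it evaluates the integral that remains after taking expectations.
\<close>
lemma nn_integral_stretched_exponential:
  fixes a b :: real
  assumes "0 < a" "0 < b"
  shows "(\<integral>\<^sup>+u\<in>{0<..}. ennreal (b * u powr (b - 1) * exp (- (a * u powr b))) \<partial>lborel) = ennreal (1 / a)"
proof -
  let ?f = "\<lambda>u. b * u powr (b - 1) * exp (- (a * u powr b))"
  let ?F = "\<lambda>u. - exp (- (a * u powr b)) / a"
  have lim0: "(?F \<longlongrightarrow> - 1 / a) (at_right 0)"
    using assms by real_asymp (simp add: field_simps)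
  have lim_inf: "(?F \<longlongrightarrow> 0) at_top"
    using assms by real_asymp
  have lim0': "((?F \<circ> real_of_ereal) \<longlongrightarrow> - 1 / a) (at_right 0)"
    using lim0 by (simp add: zero_ereal_def ereal_tendsto_simps)
  have lim_inf': "((?F \<circ> real_of_ereal) \<longlongrightarrow> 0) (at_left \<infinity>)"
    using lim_inf by (simp add: ereal_tendsto_simps)
  have deriv: "DERIV ?F u :> ?f u" and cont: "isCont ?f u" if "0 < ereal u" for u
    using that assms by (auto intro!: derivative_eq_intros continuous_intros simp: zero_ereal_def field_simps)
  have nonneg: "AE u in lborel. 0 < ereal u \<longrightarrow> ereal u < \<infinity> \<longrightarrow> 0 \<le> ?f u"
    using assms by auto
  note FTC = interval_integral_FTC_nonneg[OF _ deriv cont nonneg lim0' lim_inf']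
  have int: "set_integrable lborel (einterval 0 \<infinity>) ?f"
    by (rule FTC(1)) auto
  have eq: "(LBINT u=0..\<infinity>. ?f u) = 0 - (- 1 / a)"
    by (rule FTC(2)) auto
  have "(\<integral>\<^sup>+u\<in>{0<..}. ennreal (?f u) \<partial>lborel) = (\<integral>\<^sup>+u. ennreal (indicator {0<..} u *\<^sub>R ?f u) \<partial>lborel)"
    by (intro nn_integral_cong) (auto split: split_indicator)
  also have "\<dots> = ennreal (LBINT u:{0<..}. ?f u)"
    using int assms unfolding set_lebesgue_integral_def set_integrable_def
    by (intro nn_integral_eq_integral) (auto simp: zero_ereal_def einterval_eq_Ici)
  also have "(LBINT u:{0<..}. ?f u) = 1 / a"
    using eq by (simp add: interval_lebesgue_integral_0_infty)
  finally show ?thesis .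
qed

text \<open>
  Writing \<open>y / (y + c * x)\<close> as the integral over \<open>u > 0\<close> of
  \<open>(y * exp (- (u * y))) * exp (- (c * u * x))\<close> separates the variables. By Tonelli the expectations
  can be taken first; they are the two stable Laplace formulas at \<open>u\<close> and at \<open>c * u\<close>. The factor
  \<open>b * u powr (b - 1)\<close> in the first makes the remaining integrand a derivative in \<open>u\<close>.
\<close>
lemma nn_integral_stable_ratio:
  assumes b: "0 < b" "b \<le> 1" and c: "0 \<le> c"
    and D1: "one_sided_stable_distribution b D1" and D2: "one_sided_stable_distribution b D2"
  shows "(\<integral>\<^sup>+y. \<integral>\<^sup>+x. ennreal (y / (y + c * x)) \<partial>D1 \<partial>D2) = ennreal (1 / (1 + c powr b))"
proof -
  interpret D1: real_distribution D1 by (rule one_sided_stable_distributionD(1)[OF D1])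
  interpret D2: real_distribution D2 by (rule one_sided_stable_distributionD(1)[OF D2])
  interpret P1: pair_sigma_finite lborel D1 ..
  interpret P2: pair_sigma_finite lborel D2 ..
  let ?g = "\<lambda>u y. ennreal (y * exp (- (u * y)))"
  let ?h = "\<lambda>u x. ennreal (exp (- ((c * u) * x)))"
  let ?I = "\<lambda>u. indicator {0<..} u :: ennreal"
  \<comment> \<open>The stretched exponential integral with index 1 and rate \<open>y + c * x\<close>.\<close>
  have ratio: "ennreal (y / (y + c * x)) = (\<integral>\<^sup>+u. ?I u * (?g u y * ?h u x) \<partial>lborel)"
    if "0 < y" "0 \<le> x" for x y
  proof -
    have pos: "0 < y + c * x"
      using that c by (intro add_pos_nonneg) auto
    have "(\<integral>\<^sup>+u. ?I u * (?g u y * ?h u x) \<partial>lborel)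
        = (\<integral>\<^sup>+u. ennreal y * (ennreal (1 * u powr (1 - 1) * exp (- ((y + c * x) * u powr 1))) * ?I u) \<partial>lborel)"
    proof (intro nn_integral_cong)
      fix u :: real
      have "y * exp (- (u * y)) * exp (- (c * u * x)) = y * exp (- ((y + c * x) * u))"
        by (simp add: algebra_simps flip: exp_add)
      then show "?I u * (?g u y * ?h u x)
          = ennreal y * (ennreal (1 * u powr (1 - 1) * exp (- ((y + c * x) * u powr 1))) * ?I u)"
        using that by (auto split: split_indicator simp flip: ennreal_mult)
    qed
    also have "\<dots> = ennreal y * ennreal (1 / (y + c * x))"
      by (subst nn_integral_cmult, measurable, subst nn_integral_stretched_exponential[OF pos]) auto
    finally show ?thesis
      using that pos by (simp flip: ennreal_mult)
  qed
  have "(\<integral>\<^sup>+y. \<integral>\<^sup>+x. ennreal (y / (y + c * x)) \<partial>D1 \<partial>D2)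
      = (\<integral>\<^sup>+y. \<integral>\<^sup>+x. \<integral>\<^sup>+u. ?I u * (?g u y * ?h u x) \<partial>lborel \<partial>D1 \<partial>D2)"
  proof (rule nn_integral_cong_AE)
    show "AE y in D2. (\<integral>\<^sup>+x. ennreal (y / (y + c * x)) \<partial>D1)
        = (\<integral>\<^sup>+x. \<integral>\<^sup>+u. ?I u * (?g u y * ?h u x) \<partial>lborel \<partial>D1)"
      using AE_stable_pos[OF b D2]
    proof eventually_elim
      case (elim y)
      show ?case
        using one_sided_stable_distributionD(2)[OF D1]
        by (intro nn_integral_cong_AE, eventually_elim) (rule ratio[OF elim])
    qed
  qed
  also have "\<dots> = (\<integral>\<^sup>+y. \<integral>\<^sup>+u. \<integral>\<^sup>+x. ?I u * (?g u y * ?h u x) \<partial>D1 \<partial>lborel \<partial>D2)"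
    by (intro nn_integral_cong P1.Fubini') measurable
  also have "\<dots> = (\<integral>\<^sup>+u. \<integral>\<^sup>+y. \<integral>\<^sup>+x. ?I u * (?g u y * ?h u x) \<partial>D1 \<partial>D2 \<partial>lborel)"
    by (intro P2.Fubini') measurable
  also have "\<dots> = (\<integral>\<^sup>+u. ?I u * ((\<integral>\<^sup>+y. ?g u y \<partial>D2) * (\<integral>\<^sup>+x. ?h u x \<partial>D1)) \<partial>lborel)"
    by (simp add: nn_integral_cmult nn_integral_multc)
  also have "\<dots> = (\<integral>\<^sup>+u\<in>{0<..}. ennreal (b * u powr (b - 1) * exp (- ((1 + c powr b) * u powr b))) \<partial>lborel)"
  proof (intro nn_integral_cong)
    fix u :: real
    show "?I u * ((\<integral>\<^sup>+y. ?g u y \<partial>D2) * (\<integral>\<^sup>+x. ?h u x \<partial>D1))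
      = ennreal (b * u powr (b - 1) * exp (- ((1 + c powr b) * u powr b))) * ?I u"
    proof (cases "0 < u")
      case True
      have "exp (- ((1 + c powr b) * u powr b)) = exp (- (u powr b)) * exp (- ((c * u) powr b))"
        using True c by (simp add: powr_mult algebra_simps flip: exp_add)
      then show ?thesis
        using True b c
        by (simp add: nn_integral_mult_exp_stable[OF b D2] nn_integral_exp_stable[OF b D1]
            flip: ennreal_mult)
    qed auto
  qed
  also have "\<dots> = ennreal (1 / (1 + c powr b))"
    using b by (intro nn_integral_stretched_exponential) (auto simp: add_pos_nonneg)
  finally show ?thesis .
qed

section \<open>The characteristic function of the Laplace law\<close>

lemma
  fixes w :: complex
  assumes w: "0 < Re w"
  shows integrable_exp_halfline:
      "set_integrable lborel {0<..} (\<lambda>x. exp (- (w * complex_of_real x)))"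
    and integral_exp_halfline:
      "(CLBINT x:{0<..}. exp (- (w * complex_of_real x))) = 1 / w"
proof -
  let ?f = "\<lambda>x. exp (- (w * complex_of_real x))"
  let ?F = "\<lambda>x. - exp (- (w * complex_of_real x)) / w"
  have w0: "w \<noteq> 0"
    using w by auto
  have "set_integrable lborel {0<..} (\<lambda>x. exp (- (Re w * x)))"
  proof -
    have "((\<lambda>x. - exp (- (Re w * x)) / Re w) \<longlongrightarrow> - 1 / Re w) (at_right 0)"
      by (rule tendsto_eq_intros refl | use w in simp)+
    moreover have "((\<lambda>x. - exp (- (Re w * x)) / Re w) \<longlongrightarrow> 0) at_top"
      using w by real_asymp
    ultimately have "set_integrable lborel (einterval 0 \<infinity>) (\<lambda>x. exp (- (Re w * x)))"
      using w
      by (intro interval_integral_FTC_nonneg(1)[where F = "\<lambda>x. - exp (- (Re w * x)) / Re w"])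
         (auto intro!: derivative_eq_intros simp: zero_ereal_def ereal_tendsto_simps)
    then show ?thesis
      by (simp add: zero_ereal_def einterval_eq_Ici)
  qed
  then show int: "set_integrable lborel {0<..} ?f"
    unfolding set_integrable_def
    by (rule Bochner_Integration.integrable_bound) (auto split: split_indicator)
  \<comment> \<open>The antiderivative of the complex exponential dies out at infinity because its modulus does.\<close>
  have "((\<lambda>x. exp (- (Re w * x))) \<longlongrightarrow> 0) at_top"
    using w by real_asymp
  then have "(?f \<longlongrightarrow> 0) at_top"
    by (intro tendsto_norm_zero_cancel[of ?f]) simp
  then have lim_inf: "(?F \<longlongrightarrow> - 0 / w) at_top"
    by (intro tendsto_intros w0)
  have "(CLBINT x=0..\<infinity>. ?f x) = - 0 / w - (- 1 / w)"
  proof (rule interval_integral_FTC_integrable[where F = ?F])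
    show "(?F has_vector_derivative ?f x) (at x)" for x
    proof -
      have "((\<lambda>z. - exp (- (w * z)) / w) has_field_derivative ?f x) (at (complex_of_real x))"
        using w0 by (auto intro!: derivative_eq_intros)
      then show ?thesis
        by (rule has_vector_derivative_real_field)
    qed
    show "set_integrable lborel (einterval 0 \<infinity>) ?f"
      using int by (simp add: zero_ereal_def einterval_eq_Ici)
    have "(?F \<longlongrightarrow> - 1 / w) (at_right 0)"
      by (rule tendsto_eq_intros refl | use w0 in simp)+
    then show "((?F \<circ> real_of_ereal) \<longlongrightarrow> - 1 / w) (at_right 0)"
      by (simp add: zero_ereal_def ereal_tendsto_simps)
    show "((?F \<circ> real_of_ereal) \<longlongrightarrow> - 0 / w) (at_left \<infinity>)"
      using lim_inf by (simp add: ereal_tendsto_simps)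
  qed (auto intro!: continuous_intros)
  then show "(CLBINT x:{0<..}. ?f x) = 1 / w"
    by (simp add: interval_lebesgue_integral_0_infty)
qed

text \<open>
  Up to the factor 1/2, the two half-lines contribute the Laplace integrals of the
  constant 1 at \<open>1 - \<i> * t\<close> and at its conjugate.
\<close>
lemma integral_laplace_density_iexp:
  "(CLINT x|lborel. complex_of_real (laplace_density x) * iexp (t * x)) = of_real (1 / (1 + t\<^sup>2))"
proof -
  let ?h = "\<lambda>s x. indicator {0<..} x *\<^sub>R exp (- ((1 - \<i> * of_real s) * complex_of_real x))"
  have h: "integrable lborel (?h s)" "(CLINT x|lborel. ?h s x) = 1 / (1 - \<i> * of_real s)" for s
    using integrable_exp_halfline[of "1 - \<i> * of_real s"] integral_exp_halfline[of "1 - \<i> * of_real s"]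
    by (simp_all add: set_integrable_def set_lebesgue_integral_def)
  have refl: "integrable lborel (\<lambda>x. ?h (- t) (- x))"
    "(CLINT x|lborel. ?h (- t) (- x)) = 1 / (1 - \<i> * of_real (- t))"
    using h[of "- t"] lborel_integrable_real_affine[of "?h (- t)" "- 1" 0]
      lborel_integral_real_affine[of "- 1" "?h (- t)" 0]
    by (simp_all only: mult_minus1 add_0) auto
  have exp_eq: "exp (- ((1 - \<i> * of_real s) * complex_of_real y)) = of_real (exp (- y)) * iexp (s * y)" for s y
  proof -
    have "- ((1 - \<i> * of_real s) * complex_of_real y) = of_real (- y) + \<i> * of_real (s * y)"
      by (simp add: algebra_simps)
    then show ?thesis
      by (simp only: exp_add exp_of_real)
  qed
  have split: "complex_of_real (laplace_density x) * iexp (t * x) = (?h t x + ?h (- t) (- x)) / 2"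
    if "x \<noteq> 0" for x
    using that by (cases "0 < x") (simp_all add: exp_eq laplace_density_def del: of_real_minus of_real_mult)
  have "(CLINT x|lborel. complex_of_real (laplace_density x) * iexp (t * x))
      = (CLINT x|lborel. (?h t x + ?h (- t) (- x)) / 2)"
  proof (rule integral_cong_AE)
    show "AE x in lborel. complex_of_real (laplace_density x) * iexp (t * x) = (?h t x + ?h (- t) (- x)) / 2"
      using AE_lborel_singleton[of 0] by eventually_elim (rule split)
  qed (simp_all add: laplace_density_def[abs_def])
  also have "\<dots> = (1 / (1 - \<i> * of_real t) + 1 / (1 - \<i> * of_real (- t))) / 2"
    using h refl by simp
  also have "\<dots> = 1 / ((1 - \<i> * of_real t) * (1 + \<i> * of_real t))"
    by (auto simp: complex_eq_iff divide_simps)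
  also have "(1 - \<i> * of_real t) * (1 + \<i> * of_real t) = complex_of_real (1 + t\<^sup>2)"
    by (simp add: complex_eq_iff power2_eq_square algebra_simps)
  finally show ?thesis
    by simp
qed

section \<open>Scale mixtures of Laplace laws\<close>

text \<open>
  Integrating out the Laplace factor first, with the independent scale \<open>W\<close> held fixed, leaves the
  Laplace characteristic function at \<open>t * W\<close>.
\<close>
lemma char_laplace_scale_mixture:
  assumes "prob_space M" and X: "distributed M lborel X laplace_density"
    and indep: "prob_space.indep_var M borel X borel W"
  shows "char (distr M borel (\<lambda>\<omega>. X \<omega> * W \<omega>)) t = of_real (\<integral>\<omega>. 1 / (1 + (t * W \<omega>)\<^sup>2) \<partial>M)"
proof -
  interpret prob_space M by fact
  have rv [measurable]: "X \<in> borel_measurable M" "W \<in> borel_measurable M"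
    using indep_var_rv1[OF indep] indep_var_rv2[OF indep] by auto
  let ?DX = "distr M borel X" and ?DW = "distr M borel W"
  interpret DX: prob_space ?DX by (rule prob_space_distr) simp
  interpret DW: prob_space ?DW by (rule prob_space_distr) simp
  interpret P: pair_prob_space ?DX ?DW ..
  have joint: "?DX \<Otimes>\<^sub>M ?DW = distr M (borel \<Otimes>\<^sub>M borel) (\<lambda>\<omega>. (X \<omega>, W \<omega>))"
    using indep by (simp add: indep_var_distribution_eq)
  have "?DX = density lborel laplace_density"
    using distributed_distr_eq_density[OF X] by (simp cong: distr_cong)
  then have char_X: "(CLINT x|?DX. iexp (s * x)) = of_real (1 / (1 + s\<^sup>2))" for s
    by (simp add: integral_density laplace_density_def[abs_def] scaleR_conv_of_real
        integral_laplace_density_iexp[unfolded laplace_density_def] del: of_real_mult of_real_divide)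
  have "char (distr M borel (\<lambda>\<omega>. X \<omega> * W \<omega>)) t = (CLINT \<omega>|M. iexp (t * (X \<omega> * W \<omega>)))"
    by (simp add: char_def integral_distr)
  also have "\<dots> = (CLINT p|?DX \<Otimes>\<^sub>M ?DW. (case p of (x, w) \<Rightarrow> iexp ((t * w) * x)))"
    unfolding joint by (subst integral_distr) (auto simp: mult_ac)
  also have "\<dots> = (CLINT w|?DW. CLINT x|?DX. iexp ((t * w) * x))"
    by (intro P.integral_snd[symmetric] P.integrable_const_bound[of _ 1])
       (auto simp: split_beta' simp del: of_real_mult)
  also have "\<dots> = of_real (\<integral>\<omega>. 1 / (1 + (t * W \<omega>)\<^sup>2) \<partial>M)"
    by (simp only: char_X integral_complex_of_real) (simp add: integral_distr)
  finally show ?thesis .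
qed

text \<open>
  For \<open>S \<ge> 0\<close> and \<open>S' > 0\<close> the integrand is \<open>S' / (S' + t\<^sup>2 * S)\<close>, so this is the stable ratio formula
  with \<open>c = t\<^sup>2\<close>.
\<close>
lemma integral_stable_mixture:
  assumes "prob_space M" and b: "0 < b" "b \<le> 1"
    and S: "one_sided_stable_distribution b (distr M borel S)"
    and S': "one_sided_stable_distribution b (distr M borel S')"
    and indep: "prob_space.indep_var M borel S borel S'"
  shows "(\<integral>\<omega>. 1 / (1 + (t * sqrt (S \<omega> / S' \<omega>))\<^sup>2) \<partial>M) = 1 / (1 + \<bar>t\<bar> powr (2 * b))"
proof -
  interpret prob_space M by fact
  have rv [measurable]: "S \<in> borel_measurable M" "S' \<in> borel_measurable M"
    using indep_var_rv1[OF indep] indep_var_rv2[OF indep] by auto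
  let ?D = "distr M borel S" and ?D' = "distr M borel S'"
  interpret D: prob_space ?D by (rule prob_space_distr) simp
  interpret D': prob_space ?D' by (rule prob_space_distr) simp
  interpret P: pair_prob_space ?D ?D' ..
  have joint: "?D \<Otimes>\<^sub>M ?D' = distr M (borel \<Otimes>\<^sub>M borel) (\<lambda>\<omega>. (S \<omega>, S' \<omega>))"
    using indep by (simp add: indep_var_distribution_eq)
  have nonneg: "AE \<omega> in M. 0 \<le> S \<omega>"
    using one_sided_stable_distributionD(2)[OF S] by (subst (asm) AE_distr_iff) auto
  have pos: "AE \<omega> in M. 0 < S' \<omega>"
    using AE_stable_pos[OF b S'] by (subst (asm) AE_distr_iff) auto
  have "(\<integral>\<^sup>+\<omega>. ennreal (1 / (1 + (t * sqrt (S \<omega> / S' \<omega>))\<^sup>2)) \<partial>M)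
      = (\<integral>\<^sup>+\<omega>. ennreal (S' \<omega> / (S' \<omega> + t\<^sup>2 * S \<omega>)) \<partial>M)"
  proof (rule nn_integral_cong_AE)
    show "AE \<omega> in M. ennreal (1 / (1 + (t * sqrt (S \<omega> / S' \<omega>))\<^sup>2)) = ennreal (S' \<omega> / (S' \<omega> + t\<^sup>2 * S \<omega>))"
      using nonneg pos
    proof eventually_elim
      case (elim \<omega>)
      then have "1 + (t * sqrt (S \<omega> / S' \<omega>))\<^sup>2 = (S' \<omega> + t\<^sup>2 * S \<omega>) / S' \<omega>"
        by (simp add: power_mult_distrib add_divide_distrib)
      then show ?case by simp
    qed
  qed
  also have "\<dots> = (\<integral>\<^sup>+p. (case p of (x, y) \<Rightarrow> ennreal (y / (y + t\<^sup>2 * x))) \<partial>(?D \<Otimes>\<^sub>M ?D'))"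
    unfolding joint by (subst nn_integral_distr) auto
  also have "\<dots> = (\<integral>\<^sup>+y. \<integral>\<^sup>+x. ennreal (y / (y + t\<^sup>2 * x)) \<partial>?D \<partial>?D')"
    by (subst P.nn_integral_snd[symmetric]) auto
  also have "\<dots> = ennreal (1 / (1 + t\<^sup>2 powr b))"
    by (rule nn_integral_stable_ratio[OF b _ S S']) simp
  also have "t\<^sup>2 powr b = \<bar>t\<bar> powr (2 * b)"
  proof -
    have "t\<^sup>2 = \<bar>t\<bar> powr 2"
      by (cases "t = 0") simp_all
    then show ?thesis
      by (simp only: powr_powr)
  qed
  finally show ?thesis
    by (subst integral_eq_nn_integral) (auto intro!: enn2real_ennreal)
qed

theorem theorem2:
  fixes \<alpha> :: real
    and N :: "'b measure" and L :: "'b \<Rightarrow> real"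
    and M :: "'a measure" and \<Lambda> S S' :: "'a \<Rightarrow> real"
  assumes "0 < \<alpha>" and "\<alpha> \<le> 2"
    and "prob_space N" and "L \<in> borel_measurable N"
    and "linnik_distribution \<alpha> (distr N borel L)"
    and "prob_space M"
    and "distributed M lborel \<Lambda> laplace_density"
    and "S \<in> borel_measurable M" and "S' \<in> borel_measurable M"
    and "one_sided_stable_distribution (\<alpha> / 2) (distr M borel S)"
    and "one_sided_stable_distribution (\<alpha> / 2) (distr M borel S')"
    and "prob_space.indep_vars M (\<lambda>_. borel) (\<lambda>i. [\<Lambda>, S, S'] ! i) {0, 1, 2}"
  shows "distr N borel L = distr M borel (\<lambda>\<omega>. \<Lambda> \<omega> * sqrt (S \<omega> / S' \<omega>))"
proof -
  interpret prob_space M by fact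
  let ?X = "\<lambda>i \<omega>. ([\<Lambda>, S, S'] ! i) \<omega>"
  let ?W = "\<lambda>\<omega>. sqrt (S \<omega> / S' \<omega>)"
  \<comment> \<open>Blocks of disjoint indices of an independent family are independent: \<open>{0}\<close> against \<open>{1, 2}\<close>
    separates the Laplace factor from the scale, and \<open>{1}\<close> against \<open>{2}\<close> the two stable variables.\<close>
  note restrict = indep_var_restrict[OF assms(12)]
  have "indep_var borel ((\<lambda>f. f 0) \<circ> (\<lambda>\<omega>. restrict (\<lambda>i. ?X i \<omega>) {0}))
      borel ((\<lambda>f. sqrt (f 1 / f 2)) \<circ> (\<lambda>\<omega>. restrict (\<lambda>i. ?X i \<omega>) {1, 2}))"
    by (intro indep_var_compose[OF restrict]) auto
  then have indep_\<Lambda>: "indep_var borel \<Lambda> borel ?W"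
    by (simp add: comp_def)
  have "indep_var borel ((\<lambda>f. f 1) \<circ> (\<lambda>\<omega>. restrict (\<lambda>i. ?X i \<omega>) {1}))
      borel ((\<lambda>f. f 2) \<circ> (\<lambda>\<omega>. restrict (\<lambda>i. ?X i \<omega>) {2}))"
    by (intro indep_var_compose[OF restrict]) auto
  then have indep_S: "indep_var borel S borel S'"
    by (simp add: comp_def)
  have b: "0 < \<alpha> / 2" "\<alpha> / 2 \<le> 1"
    using assms(1,2) by auto
  have "char (distr M borel (\<lambda>\<omega>. \<Lambda> \<omega> * ?W \<omega>)) t = of_real (1 / (1 + \<bar>t\<bar> powr \<alpha>))" for t
    unfolding char_laplace_scale_mixture[OF assms(6,7) indep_\<Lambda>]
      integral_stable_mixture[OF assms(6) b assms(10,11) indep_S] by simp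
  then have "char (distr N borel L) = char (distr M borel (\<lambda>\<omega>. \<Lambda> \<omega> * ?W \<omega>))"
    using assms(5) by (auto simp: linnik_distribution_def)
  moreover have "real_distribution (distr N borel L)"
    using assms(5) by (simp add: linnik_distribution_def)
  moreover have "(\<lambda>\<omega>. \<Lambda> \<omega> * ?W \<omega>) \<in> borel_measurable M"
    using indep_var_rv1[OF indep_\<Lambda>] indep_var_rv2[OF indep_\<Lambda>] by (intro borel_measurable_times)
  then have "real_distribution (distr M borel (\<lambda>\<omega>. \<Lambda> \<omega> * ?W \<omega>))"
    by (rule real_distribution_distr)
  ultimately show ?thesis
    by (intro Levy_uniqueness)
qed

end
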